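(* Let $\mathcal{P}=\{1,\dots,\kappa\}$ (providers) and $\mathcal{Q}=\{1,\dots,m\}$ (items) be finite sets, and let $\alpha\ge 0$. For each $i\in\mathcal{P}$ let $f_i:2^{\mathcal{Q}}\to\mathbb{R}_{\ge 0}$ be submodular, and let $F(\mathscr{S})=\sum_{i=1}^{\kappa} f_i(\mathcal{S}_i)$ for an allocation $\mathscr{S}=(\mathcal{S}_1,\dots,\mathcal{S}_\kappa)$. Let $T(\mathscr{S},\mathscr{R})\in\mathbb{R}$ be a routing cost such that, for every fixed routing assignment $\mathscr{R}=(\mathcal{R}_1,\dots,\mathcal{R}_\kappa)$, the map $\mathscr{S}\mapsto T(\mathscr{S},\mathscr{R})$ is supermodular. Then for any fixed routing assignment $\mathscr{R}$, the function $$f_{\mathscr{R}}(\mathscr{S})=F(\mathscr{S})-\alpha\,T(\mathscr{S},\mathscr{R})$$ is submodular in $\mathscr{S}$.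
   Context: An allocation $\mathscr{S}=(\mathcal{S}_1,\dots,\mathcal{S}_\kappa)$, $\mathcal{S}_i\subseteq\mathcal{Q}$, is identified with the subset $A=\{(i,q):q\in\mathcal{S}_i\}$ of the ground set $X=\mathcal{P}\times\mathcal{Q}$; the pair $(i,q)$ means that item $q$ is assigned to provider $i$. Submodularity or supermodularity in $\mathscr{S}$ means that of the corresponding set function on $2^X$. A set function $g:2^{X}\to\mathbb{R}$ is submodular if for all $A\subseteq B\subseteq X$ and all $x\in X\setminus B$ one has $g(A\cup\{x\})-g(A)\ge g(B\cup\{x\})-g(B)$; it is supermodular if $-g$ is submodular. A routing assignment $\mathscr{R}=(\mathcal{R}_1,\dots,\mathcal{R}_\kappa)$ chooses for each provider $i$ one path $\mathcal{R}_i$ from a finite non-empty set of directed simple paths from node $i$ to the client node $c$ in a finite directed weighted graph. *)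

theory Defs
  imports "HOL-Library.FuncSet" "Graph_Theory.Weighted_Graph"
begin

definition submodular_on :: "'a set \<Rightarrow> ('a set \<Rightarrow> real) \<Rightarrow> bool" where
  "submodular_on X g \<longleftrightarrow>
     (\<forall>A B x. A \<subseteq> B \<and> B \<subseteq> X \<and> x \<in> X - B \<longrightarrow>
        g (A \<union> {x}) - g A \<ge> g (B \<union> {x}) - g B)"

definition supermodular_on :: "'a set \<Rightarrow> ('a set \<Rightarrow> real) \<Rightarrow> bool" where
  "supermodular_on X g \<longleftrightarrow> submodular_on X (\<lambda>A. - g A)"

text \<open>
  An allocation of items Q to providers P is a P-indexed family of subsets of Q. It is identified
  with the set \<open>Sigma P S\<close> of pairs (i, q) with q in S i; the inverse of this identification
  is \<open>allocation_of P\<close> (see the lemmas below).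
\<close>

definition allocations :: "'p set \<Rightarrow> 'q set \<Rightarrow> ('p \<Rightarrow> 'q set) set" where
  "allocations P Q = (\<Pi>\<^sub>E i\<in>P. Pow Q)"

definition allocation_of :: "'p set \<Rightarrow> ('p \<times> 'q) set \<Rightarrow> 'p \<Rightarrow> 'q set" where
  "allocation_of P A = (\<lambda>i\<in>P. A `` {i})"

lemma allocation_of_in_allocations:
  "A \<subseteq> P \<times> Q \<Longrightarrow> allocation_of P A \<in> allocations P Q"
  by (auto simp: allocation_of_def allocations_def)

lemma Sigma_allocation_of: "A \<subseteq> P \<times> Q \<Longrightarrow> Sigma P (allocation_of P A) = A"
  by (auto simp: allocation_of_def)

lemma allocation_of_Sigma: "S \<in> allocations P Q \<Longrightarrow> allocation_of P (Sigma P S) = S"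
  by (rule ext) (auto simp: allocation_of_def allocations_def restrict_def PiE_def extensional_def)

definition submodular_alloc :: "'p set \<Rightarrow> 'q set \<Rightarrow> (('p \<Rightarrow> 'q set) \<Rightarrow> real) \<Rightarrow> bool" where
  "submodular_alloc P Q h \<longleftrightarrow> submodular_on (P \<times> Q) (\<lambda>A. h (allocation_of P A))"

definition supermodular_alloc :: "'p set \<Rightarrow> 'q set \<Rightarrow> (('p \<Rightarrow> 'q set) \<Rightarrow> real) \<Rightarrow> bool" where
  "supermodular_alloc P Q h \<longleftrightarrow> supermodular_on (P \<times> Q) (\<lambda>A. h (allocation_of P A))"

definition total_value :: "'p set \<Rightarrow> ('p \<Rightarrow> 'q set \<Rightarrow> real) \<Rightarrow> ('p \<Rightarrow> 'q set) \<Rightarrow> real" where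
  "total_value P f S = (\<Sum>i\<in>P. f i (S i))"

text \<open>The weights are not restricted in sign; parallel arcs and loops are permitted.\<close>

record ('v, 'e) weighted_digraph =
  base_graph :: "('v, 'e) pre_digraph"
  weight :: "'e weight_fun"

definition simple_paths :: "('v, 'e) weighted_digraph \<Rightarrow> 'v \<Rightarrow> 'v \<Rightarrow> 'e awalk set" where
  "simple_paths N u v = {p. pre_digraph.apath (base_graph N) u p v}"

text \<open>
  \<open>K i\<close> is the set of candidate paths of provider i. Providers are themselves nodes of the network.
\<close>

definition candidate_paths ::
  "('v, 'e) weighted_digraph \<Rightarrow> 'v \<Rightarrow> 'v set \<Rightarrow> ('v \<Rightarrow> 'e awalk set) \<Rightarrow> bool" where
  "candidate_paths N c P K \<longleftrightarrow>
     (\<forall>i\<in>P. finite (K i) \<and> K i \<noteq> {} \<and> K i \<subseteq> simple_paths N i c)"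

definition routing_assignments :: "'v set \<Rightarrow> ('v \<Rightarrow> 'e awalk set) \<Rightarrow> ('v \<Rightarrow> 'e awalk) set" where
  "routing_assignments P K = (\<Pi>\<^sub>E i\<in>P. K i)"

end

theory Submission
  imports Defs
begin

text \<open>
  Adding a pair \<open>(j, q)\<close> to an allocation changes the bundle of provider \<open>j\<close> only, and changes it
  by the single item \<open>q\<close>. Hence the marginal value of that pair for \<open>f i\<close>, read as a function of
  the whole allocation, is zero if \<open>i \<noteq> j\<close> and is the marginal value of \<open>q\<close> for \<open>f i\<close> otherwise; in both cases
  it cannot grow with the allocation (\<open>submodular_on_section\<close>). Marginal values are linear in the
  set function, so submodular functions form a convex cone (\<open>submodular_on_sum\<close>,
  \<open>submodular_on_add\<close>, \<open>submodular_on_scale\<close>). This cone contains the total value and, as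
  \<open>\<alpha> \<ge> 0\<close> and the routing cost is supermodular, also \<open>-\<alpha>\<close> times the routing cost.
\<close>

lemma submodular_on_sum:
  assumes "\<And>i. i \<in> I \<Longrightarrow> submodular_on X (g i)"
  shows "submodular_on X (\<lambda>A. \<Sum>i\<in>I. g i A)"
  using assms unfolding submodular_on_def
  by (auto simp flip: sum_subtractf intro!: sum_mono)

lemma submodular_on_add:
  assumes "submodular_on X g" and "submodular_on X h"
  shows "submodular_on X (\<lambda>A. g A + h A)"
  unfolding submodular_on_def
proof (intro allI impI)
  fix A B x
  assume "A \<subseteq> B \<and> B \<subseteq> X \<and> x \<in> X - B"
  then have "g (A \<union> {x}) - g A \<ge> g (B \<union> {x}) - g B"
    and "h (A \<union> {x}) - h A \<ge> h (B \<union> {x}) - h B"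
    using assms unfolding submodular_on_def by blast+
  then show "g (A \<union> {x}) + h (A \<union> {x}) - (g A + h A)
      \<ge> g (B \<union> {x}) + h (B \<union> {x}) - (g B + h B)"
    by linarith
qed

lemma submodular_on_scale:
  assumes "submodular_on X g" and "a \<ge> 0"
  shows "submodular_on X (\<lambda>A. a * g A)"
  using assms unfolding submodular_on_def
  by (auto simp flip: right_diff_distrib intro!: mult_left_mono)

lemma submodular_on_section:
  fixes P :: "'p set" and Q :: "'q set"
  assumes g: "submodular_on Q g" and "i \<in> P"
  shows "submodular_on (P \<times> Q) (\<lambda>A. g (allocation_of P A i))"
  unfolding submodular_on_def
proof (intro allI impI)
  fix A B :: "('p \<times> 'q) set" and x
  assume AB: "A \<subseteq> B \<and> B \<subseteq> P \<times> Q \<and> x \<in> P \<times> Q - B"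
  obtain j q where x: "x = (j, q)" by (cases x)
  have sect: "allocation_of P C i = C `` {i}" for C :: "('p \<times> 'q) set"
    using \<open>i \<in> P\<close> by (simp add: allocation_of_def)
  show "g (allocation_of P (A \<union> {x}) i) - g (allocation_of P A i)
      \<ge> g (allocation_of P (B \<union> {x}) i) - g (allocation_of P B i)"
  proof (cases "j = i")
    case True
    have "(C \<union> {x}) `` {i} = C `` {i} \<union> {q}" for C
      using x True by auto
    moreover have "A `` {i} \<subseteq> B `` {i}" "B `` {i} \<subseteq> Q" "q \<in> Q - B `` {i}"
      using AB x True by auto
    ultimately show ?thesis
      using g unfolding submodular_on_def sect by simp
  next
    case False
    have "(C \<union> {x}) `` {i} = C `` {i}" for C
      using x False by auto
    then show ?thesis
      unfolding sect by simp
  qed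
qed

theorem mainTheorem1:
  fixes \<kappa> m c :: nat
    and P Q :: "nat set"
    and \<alpha> :: real
    and f :: "nat \<Rightarrow> nat set \<Rightarrow> real"
    and N :: "(nat, 'e) weighted_digraph"
    and K :: "nat \<Rightarrow> 'e awalk set"
    and T :: "(nat \<Rightarrow> nat set) \<Rightarrow> (nat \<Rightarrow> 'e awalk) \<Rightarrow> real"
  assumes "P = {1..\<kappa>}"
    and "Q = {1..m}"
    and "\<alpha> \<ge> 0"
    and "\<And>i S. i \<in> P \<Longrightarrow> S \<subseteq> Q \<Longrightarrow> f i S \<ge> 0"
    and "\<And>i. i \<in> P \<Longrightarrow> submodular_on Q (f i)"
    and "fin_digraph (base_graph N)"
    and "c \<in> verts (base_graph N)"
    and "candidate_paths N c P K"
    and "\<And>R. R \<in> routing_assignments P K \<Longrightarrow> supermodular_alloc P Q (\<lambda>S. T S R)"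
  shows "\<forall>R \<in> routing_assignments P K.
           submodular_alloc P Q (\<lambda>S. total_value P f S - \<alpha> * T S R)"
proof
  fix R
  assume R: "R \<in> routing_assignments P K"
  have "submodular_on (P \<times> Q) (\<lambda>A. total_value P f (allocation_of P A))"
    unfolding total_value_def
    using assms(5) by (intro submodular_on_sum submodular_on_section)
  moreover have "submodular_on (P \<times> Q) (\<lambda>A. \<alpha> * - T (allocation_of P A) R)"
    using assms(9)[OF R] \<open>\<alpha> \<ge> 0\<close>
    unfolding supermodular_alloc_def supermodular_on_def by (rule submodular_on_scale)
  ultimately show "submodular_alloc P Q (\<lambda>S. total_value P f S - \<alpha> * T S R)"
    unfolding submodular_alloc_def by (auto dest: submodular_on_add)
qed

end
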